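(* Let $d\ge2$ and let $\mathbf p=(\mathbf p_1,\dots,\mathbf p_n)$ be a generic configuration of $n\ge d+2$ points in $\mathbb R^d$. Let $\mathbf v=\langle G,\mathbf p\rangle^2$, where $G$ is an edge measurement ensemble on $\{1,\dots,n\}$. Suppose there is a configuration $\mathbf q=(\mathbf q_1,\dots,\mathbf q_{n'})$ of $n'$ points in $\mathbb R^d$, no two of which are coincident, along with an edge measurement ensemble $H$ on $\{1,\dots,n'\}$ that allows for trilateration, and let $\mathbf v^-=\langle H,\mathbf q\rangle^2$. Suppose that $\mathbf v^-$ is contained in $\mathbf v$ as a (possibly reordered) subsequence of values. Let $G^-$ be the subsequence of edges in $G$ corresponding to $\mathbf v^-$, so that $\langle G^-,\mathbf p\rangle^2=\mathbf v^-$. Let $S\subseteq\{1,\dots,n\}$ be the set of vertices that are endpoints of edges of $G^-$ and $\mathbf p_S$ the subconfiguration of $\mathbf p$ indexed by $S$. Then there is a vertex relabeling of $\mathbf p_S$ such that, up to congruence, $\mathbf q=\mathbf p_S$; moreover, under this vertex relabeling, $G^-=H$. That is, there is a bijection $\sigma:\{1,\dots,n'\}\to S$ such that $(\mathbf p_{\sigma(1)},\dots,\mathbf p_{\sigma(n')})$ is congruent to $\mathbf q$ and, for each $t$, if $H_t=\{i,j\}$ then $G^-_t=\{\sigma(i),\sigma(j)\}$.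
   Context: A configuration of $n$ points in $\mathbb R^d$ is a sequence $\mathbf p=(\mathbf p_1,\dots,\mathbf p_n)$ with $\mathbf p_i\in\mathbb R^d$; it is generic if its $dn$ coordinates satisfy no non-trivial polynomial equation with coefficients in $\mathbb Q$. Two configurations are congruent if a Euclidean isometry of $\mathbb R^d$ maps one to the other point by point, in order. An edge is an unordered pair of distinct vertices. An edge measurement ensemble on $\{1,\dots,n\}$ is a finite sequence $G=(G_1,\dots,G_k)$ of edges. $\langle G,\mathbf p\rangle^2$ denotes the sequence of squared Euclidean edge lengths, i.e. its $t$-th entry is $|\mathbf p_i-\mathbf p_j|^2$ when $G_t=\{i,j\}$. An edge measurement ensemble on $\{1,\dots,n'\}$ allows for trilateration if, after some reordering of the vertices, (i) it contains all edges of the complete graph on $\{1,\dots,d+2\}$, and (ii) for each $j$ with $d+2<j\le n'$ it contains the edges $\{i_1,j\},\dots,\{i_{d+1},j\}$ for some distinct $i_1,\dots,i_{d+1}<j$. It may contain further edges. *)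

theory Defs
  imports "HOL-Analysis.Analysis" "HOL-Library.Poly_Mapping" "HOL-Combinatorics.Permutations"
begin

text \<open>
  A configuration of \<open>n\<close> points in \<open>\<real>\<^sup>d\<close> is a function of type \<open>nat \<Rightarrow> real ^ 'd\<close>,
  with \<open>d = CARD('d)\<close>, of which only the values on \<open>{1..n}\<close> matter.
\<close>

text \<open>
  A multivariate polynomial over the rationals is a finitely supported map from monomials to
  coefficients, a monomial being a finitely supported map from variables to exponents.
  In a generic configuration the variable \<open>(i, k)\<close> stands for the \<open>k\<close>-th coordinate of the
  \<open>i\<close>-th point.
\<close>

type_synonym 'v rat_mpoly = "('v \<Rightarrow>\<^sub>0 nat) \<Rightarrow>\<^sub>0 rat"

definition eval_mpoly :: "'v rat_mpoly \<Rightarrow> ('v \<Rightarrow> real) \<Rightarrow> real" where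
  "eval_mpoly P x =
     (\<Sum>m\<in>Poly_Mapping.keys P. of_rat (Poly_Mapping.lookup P m) *
        (\<Prod>v\<in>Poly_Mapping.keys m. x v ^ Poly_Mapping.lookup m v))"

definition mpoly_in_vars :: "'v set \<Rightarrow> 'v rat_mpoly \<Rightarrow> bool" where
  "mpoly_in_vars V P \<longleftrightarrow> (\<forall>m\<in>Poly_Mapping.keys P. Poly_Mapping.keys m \<subseteq> V)"

definition generic :: "nat \<Rightarrow> (nat \<Rightarrow> real ^ 'd) \<Rightarrow> bool" where
  "generic n p \<longleftrightarrow>
     (\<forall>P. mpoly_in_vars ({1..n} \<times> (UNIV :: 'd set)) P \<and> eval_mpoly P (\<lambda>(i, k). p i $ k) = 0
          \<longrightarrow> P = 0)"

text \<open>Distance preserving self-maps of \<open>\<real>\<^sup>d\<close> are automatically bijective.\<close>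

definition congruent_config :: "nat \<Rightarrow> (nat \<Rightarrow> real ^ 'd) \<Rightarrow> (nat \<Rightarrow> real ^ 'd) \<Rightarrow> bool" where
  "congruent_config n p q \<longleftrightarrow>
     (\<exists>f :: real ^ 'd \<Rightarrow> real ^ 'd.
        (\<forall>x y. dist (f x) (f y) = dist x y) \<and> (\<forall>i\<in>{1..n}. f (p i) = q i))"

definition edge_on :: "nat \<Rightarrow> nat set \<Rightarrow> bool" where
  "edge_on n e \<longleftrightarrow> (\<exists>i j. i \<in> {1..n} \<and> j \<in> {1..n} \<and> i \<noteq> j \<and> e = {i, j})"

text \<open>The same edge may be measured more than once.\<close>

definition edge_ensemble :: "nat \<Rightarrow> nat set list \<Rightarrow> bool" where
  "edge_ensemble n G \<longleftrightarrow> (\<forall>e\<in>set G. edge_on n e)"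

text \<open>
  \<open>Min\<close> and \<open>Max\<close> only serve to pick out the two endpoints of an edge; the lemma below is
  the intended reading.
\<close>

definition edge_sqlen :: "(nat \<Rightarrow> real ^ 'd) \<Rightarrow> nat set \<Rightarrow> real" where
  "edge_sqlen p e = (norm (p (Min e) - p (Max e)))\<^sup>2"

lemma edge_sqlen_pair: "edge_sqlen p {i, j} = (norm (p i - p j))\<^sup>2"
  by (cases "i \<le> j") (auto simp: edge_sqlen_def max_def min_def norm_minus_commute)

definition measurement :: "nat set list \<Rightarrow> (nat \<Rightarrow> real ^ 'd) \<Rightarrow> real list" where
  "measurement G p = map (edge_sqlen p) G"

text \<open>
  The permutation \<open>\<pi>\<close> sends the position of a vertex in the reordering to that vertex.
  Since \<open>H\<close> has all its edges inside \<open>{1..n}\<close>, the first condition forces \<open>d + 2 \<le> n\<close>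
  (for positive \<open>d\<close>).
\<close>

definition allows_trilateration :: "nat \<Rightarrow> nat \<Rightarrow> nat set list \<Rightarrow> bool" where
  "allows_trilateration d n H \<longleftrightarrow>
     edge_ensemble n H \<and>
     (\<exists>\<pi>. \<pi> permutes {1..n} \<and>
        (\<forall>i\<in>{1..d+2}. \<forall>j\<in>{1..d+2}. i \<noteq> j \<longrightarrow> {\<pi> i, \<pi> j} \<in> set H) \<and>
        (\<forall>j. d + 2 < j \<and> j \<le> n \<longrightarrow>
           (\<exists>I. I \<subseteq> {1..<j} \<and> card I = d + 1 \<and> (\<forall>i\<in>I. {\<pi> i, \<pi> j} \<in> set H))))"

text \<open>
  \<open>\<tau>\<close> selects pairwise distinct positions, not necessarily in increasing order, of a sequence
  of length \<open>l\<close>; the selected entries form the reordered subsequence \<open>subseq_at \<tau> k xs\<close>.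
\<close>

definition selects_positions :: "nat \<Rightarrow> nat \<Rightarrow> (nat \<Rightarrow> nat) \<Rightarrow> bool" where
  "selects_positions k l \<tau> \<longleftrightarrow> inj_on \<tau> {..<k} \<and> \<tau> ` {..<k} \<subseteq> {..<l}"

definition subseq_at :: "(nat \<Rightarrow> nat) \<Rightarrow> nat \<Rightarrow> 'a list \<Rightarrow> 'a list" where
  "subseq_at \<tau> k xs = map (\<lambda>t. xs ! \<tau> t) [0..<k]"

end

theory Submission
  imports Defs
begin

text \<open>
  Write \<open>d = CARD('d)\<close>.  The heart of the matter is \<open>generic_realisation_unique\<close>: if \<open>d + 2\<close>
  points of \<open>\<real>\<^sup>d\<close> have mutual distances that all occur among the edges of a generic configuration
  \<open>p\<close>, then those edges are the edges of a complete graph on \<open>d + 2\<close> vertices of \<open>p\<close>, matched in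
  the way that a bijection of vertices dictates.

  Let \<open>f\<close> assign to each pair from the \<open>d + 2\<close> points the edge of \<open>p\<close> that has its length.  Points
  of \<open>\<real>\<^sup>d\<close> have a singular Gram matrix once there are \<open>d + 1\<close> difference vectors, and this is one
  polynomial equation with rational coefficients in the coordinates of \<open>p\<close>.  As \<open>p\<close> is generic
  the polynomial vanishes identically, so \<open>p\<close> may be replaced by any configuration \<open>y\<close>
  (\<open>generic_vanishing\<close>).  Well chosen \<open>y\<close> force the shape of \<open>f\<close>:

  \<^item> If the graph formed by the values of \<open>f\<close> is \<open>(d + 1)\<close>-colourable, place its vertices at the
    vertices of a regular simplex according to colour.  All pairs then get the same nonzero length,
    which is impossible: a regular simplex on \<open>d + 2\<close> points has a nonsingular Gram matrix.  A
    graph with at most \<open>(d + 2) choose 2\<close> edges that is not \<open>(d + 1)\<close>-colourable is complete on \<open>d + 2\<close> vertices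
    (\<open>colourable_or_complete\<close>), so \<open>f\<close> is a bijection onto the edges of such a graph.

  \<^item> Let \<open>f {i, j} = {a, b}\<close>.  Merge \<open>a\<close> and \<open>b\<close>, and put the resulting \<open>d + 1\<close> points at the vertices
    of a slightly distorted regular simplex.  Then \<open>i\<close> and \<open>j\<close> get distance zero and all other
    pairs nearly the same distance; the Gram matrix is singular only if \<open>i\<close> and \<open>j\<close> have the same
    distance to every other \<open>k\<close> (\<open>coincident_pair_rigid\<close>).  Distorting at each vertex in turn
    yields \<open>{f {i, k}, f {j, k}} = {{a, c}, {b, c}}\<close> for some \<open>c\<close>.  So \<open>f\<close> takes triangles to
    triangles, and since there are at least four points it comes from a map of vertices
    (\<open>pair_map_induced_by_triangles\<close>).

  For the theorem, the initial complete graph of the trilateration gives an isometry that carries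
  \<open>d + 2\<close> points of \<open>p\<close> to points of \<open>q\<close> (\<open>base_placement\<close>).  A further point of \<open>q\<close> together with the
  \<open>d + 1\<close> points it is attached to is again a configuration of \<open>d + 2\<close> points as above, where the
  lengths among the old points are lengths in \<open>p\<close> because these points are already placed; hence
  the same isometry carries a point of \<open>p\<close> to the new point (\<open>placement_step\<close>).  Finally, distinct
  edges of a generic configuration have distinct lengths, which identifies the edges in \<open>Gm\<close>.
\<close>

section \<open>Rational polynomial relations at a generic configuration\<close>

abbreviation monomial_value :: "('v \<Rightarrow>\<^sub>0 nat) \<Rightarrow> ('v \<Rightarrow> real) \<Rightarrow> real" where
  "monomial_value m x \<equiv> \<Prod>v\<in>Poly_Mapping.keys m. x v ^ Poly_Mapping.lookup m v"

lemma monomial_value_superset: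
  assumes "finite U" "Poly_Mapping.keys m \<subseteq> U"
  shows "monomial_value m x = (\<Prod>v\<in>U. x v ^ Poly_Mapping.lookup m v)"
  using assms by (intro prod.mono_neutral_left) (auto simp: in_keys_iff)

lemma monomial_value_add: "monomial_value (k + l) x = monomial_value k x * monomial_value l x"
proof -
  let ?U = "Poly_Mapping.keys k \<union> Poly_Mapping.keys l"
  have "monomial_value (k + l) x = (\<Prod>v\<in>?U. x v ^ Poly_Mapping.lookup (k + l) v)"
    using Poly_Mapping.keys_add[of k l] by (intro monomial_value_superset) auto
  also have "\<dots> = (\<Prod>v\<in>?U. x v ^ Poly_Mapping.lookup k v) * (\<Prod>v\<in>?U. x v ^ Poly_Mapping.lookup l v)"
    by (simp add: lookup_add power_add prod.distrib)
  also have "\<dots> = monomial_value k x * monomial_value l x"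
    by (simp add: monomial_value_superset[of ?U k] monomial_value_superset[of ?U l])
  finally show ?thesis .
qed

lemma eval_mpoly_superset:
  assumes "finite M" "Poly_Mapping.keys P \<subseteq> M"
  shows "eval_mpoly P x = (\<Sum>m\<in>M. of_rat (Poly_Mapping.lookup P m) * monomial_value m x)"
  unfolding eval_mpoly_def using assms
  by (intro sum.mono_neutral_left) (auto simp: in_keys_iff)

lemma eval_mpoly_zero: "eval_mpoly 0 x = 0"
  by (simp add: eval_mpoly_def)

lemma eval_mpoly_single: "eval_mpoly (Poly_Mapping.single m c) x = of_rat c * monomial_value m x"
  by (simp add: eval_mpoly_superset[of "{m}"])

lemma eval_mpoly_add: "eval_mpoly (P + Q) x = eval_mpoly P x + eval_mpoly Q x"
proof -
  let ?M = "Poly_Mapping.keys P \<union> Poly_Mapping.keys Q"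
  have "eval_mpoly (P + Q) x = (\<Sum>m\<in>?M. of_rat (Poly_Mapping.lookup (P + Q) m) * monomial_value m x)"
    using Poly_Mapping.keys_add[of P Q] by (intro eval_mpoly_superset) auto
  then show ?thesis
    by (simp add: lookup_add of_rat_add distrib_right sum.distrib eval_mpoly_superset[of ?M P]
        eval_mpoly_superset[of ?M Q])
qed

lemma eval_mpoly_sum: "eval_mpoly (sum P I) x = (\<Sum>i\<in>I. eval_mpoly (P i) x)"
  by (induction I rule: infinite_finite_induct) (auto simp: eval_mpoly_zero eval_mpoly_add)

text \<open>
  Reduces multiplicativity of evaluation to the case of monomials.
\<close>

lemma mpoly_eq_sum_terms:
  "P = (\<Sum>m\<in>Poly_Mapping.keys P. Poly_Mapping.single m (Poly_Mapping.lookup P m))"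
  by (rule poly_mapping_eqI) (auto simp: lookup_sum lookup_single when_def in_keys_iff)

lemma eval_mpoly_mult: "eval_mpoly (P * Q) x = eval_mpoly P x * eval_mpoly Q x"
proof -
  have "P * Q = (\<Sum>m\<in>Poly_Mapping.keys P. \<Sum>l\<in>Poly_Mapping.keys Q.
      Poly_Mapping.single (m + l) (Poly_Mapping.lookup P m * Poly_Mapping.lookup Q l))"
    by (subst mpoly_eq_sum_terms[of P], subst mpoly_eq_sum_terms[of Q])
      (simp only: sum_product mult_single)
  then show ?thesis
    by (simp add: eval_mpoly_sum eval_mpoly_single monomial_value_add of_rat_mult)
      (simp add: eval_mpoly_def sum_product algebra_simps)
qed

lemma mpoly_in_vars_add:
  "mpoly_in_vars V P \<Longrightarrow> mpoly_in_vars V Q \<Longrightarrow> mpoly_in_vars V (P + Q)"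
  unfolding mpoly_in_vars_def using Poly_Mapping.keys_add[of P Q] by blast

lemma mpoly_in_vars_mult:
  assumes "mpoly_in_vars V P" "mpoly_in_vars V Q"
  shows "mpoly_in_vars V (P * Q)"
  unfolding mpoly_in_vars_def
proof
  fix m assume "m \<in> Poly_Mapping.keys (P * Q)"
  then obtain k l where "m = k + l" "k \<in> Poly_Mapping.keys P" "l \<in> Poly_Mapping.keys Q"
    using Poly_Mapping.keys_mult[of P Q] by auto
  then show "Poly_Mapping.keys m \<subseteq> V"
    using assms Poly_Mapping.keys_add[of k l] unfolding mpoly_in_vars_def by blast
qed

text \<open>
  Polynomial functions of a configuration are given by closure rules instead of polynomials, so
  that determinants of squared lengths can be recognised as polynomial by their syntax alone.
\<close>

inductive config_poly :: "nat \<Rightarrow> ((nat \<Rightarrow> real ^ 'd) \<Rightarrow> real) \<Rightarrow> bool" for n where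
  config_poly_rat: "config_poly n (\<lambda>x. of_rat c)"
| config_poly_coord: "i \<in> {1..n} \<Longrightarrow> config_poly n (\<lambda>x. x i $ k)"
| config_poly_add: "config_poly n f \<Longrightarrow> config_poly n g \<Longrightarrow> config_poly n (\<lambda>x. f x + g x)"
| config_poly_mult: "config_poly n f \<Longrightarrow> config_poly n g \<Longrightarrow> config_poly n (\<lambda>x. f x * g x)"

lemma config_poly_imp_mpoly:
  fixes f :: "(nat \<Rightarrow> real ^ 'd) \<Rightarrow> real"
  assumes "config_poly n f"
  shows "\<exists>P. mpoly_in_vars ({1..n} \<times> (UNIV :: 'd set)) P \<and>
             (\<forall>x. f x = eval_mpoly P (\<lambda>(i, k). x i $ k))"
  using assms
proof induction
  case (config_poly_rat c)
  show ?case
    by (rule exI[of _ "Poly_Mapping.single 0 c"]) (auto simp: mpoly_in_vars_def eval_mpoly_single)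
next
  case (config_poly_coord i k)
  then show ?case
    by (intro exI[of _ "Poly_Mapping.single (Poly_Mapping.single (i, k) 1) 1"])
      (auto simp: mpoly_in_vars_def eval_mpoly_single)
next
  case (config_poly_add f g)
  then show ?case by (metis mpoly_in_vars_add eval_mpoly_add)
next
  case (config_poly_mult f g)
  then show ?case by (metis mpoly_in_vars_mult eval_mpoly_mult)
qed

text \<open>
  The only polynomial that vanishes at a generic point is the zero polynomial, so a relation that
  holds at a generic configuration may be tested on degenerate ones.
\<close>

lemma generic_vanishing:
  assumes "generic n p" "config_poly n f" "f p = 0"
  shows "f y = 0"
proof -
  obtain P where "mpoly_in_vars ({1..n} \<times> UNIV) P"
    and P: "\<And>x. f x = eval_mpoly P (\<lambda>(i, k). x i $ k)"
    using config_poly_imp_mpoly[OF assms(2)] by blast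
  then have "P = 0"
    using assms(1,3) unfolding generic_def by simp
  then show ?thesis by (simp add: P eval_mpoly_zero)
qed

lemma config_poly_of_int: "config_poly n (\<lambda>x. of_int c)"
  using config_poly_rat[of n "of_int c"] by simp

lemma config_poly_zero: "config_poly n (\<lambda>x. 0)" and config_poly_one: "config_poly n (\<lambda>x. 1)"
  using config_poly_of_int[of n 0] config_poly_of_int[of n 1] by simp_all

lemma config_poly_diff:
  assumes "config_poly n f" "config_poly n g"
  shows "config_poly n (\<lambda>x. f x - g x)"
  using config_poly_add[OF assms(1) config_poly_mult[OF config_poly_of_int[of n "-1"] assms(2)]]
  by simp

lemma config_poly_sum:
  "(\<And>i. i \<in> I \<Longrightarrow> config_poly n (f i)) \<Longrightarrow> config_poly n (\<lambda>x. \<Sum>i\<in>I. f i x)"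
  by (induction I rule: infinite_finite_induct) (auto intro: config_poly_zero config_poly_add)

lemma config_poly_prod:
  "(\<And>i. i \<in> I \<Longrightarrow> config_poly n (f i)) \<Longrightarrow> config_poly n (\<lambda>x. \<Prod>i\<in>I. f i x)"
  by (induction I rule: infinite_finite_induct) (auto intro: config_poly_one config_poly_mult)

lemma config_poly_det:
  fixes A :: "(nat \<Rightarrow> real ^ 'd) \<Rightarrow> real ^ 'm ^ 'm"
  assumes "\<And>i j. config_poly n (\<lambda>x. A x $ i $ j)"
  shows "config_poly n (\<lambda>x. det (A x))"
  unfolding det_def
  by (intro config_poly_sum config_poly_mult config_poly_of_int config_poly_prod assms)

lemma config_poly_edge_sqlen:
  assumes "edge_on n e"
  shows "config_poly n (\<lambda>x :: nat \<Rightarrow> real ^ 'd. edge_sqlen x e)"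
proof -
  obtain i j where ij: "i \<in> {1..n}" "j \<in> {1..n}" "e = {i, j}"
    using assms unfolding edge_on_def by blast
  have "config_poly n (\<lambda>x :: nat \<Rightarrow> real ^ 'd. \<Sum>k\<in>UNIV. (x i $ k - x j $ k) * (x i $ k - x j $ k))"
    by (intro config_poly_sum config_poly_mult config_poly_diff config_poly_coord ij)
  then show ?thesis
    by (simp add: ij edge_sqlen_pair power2_norm_eq_inner inner_vec_def)
qed

text \<open>
  Move a vertex of one edge that is not on the other away from the origin, where all the remaining
  points sit: the two lengths become 1 and 0, so they cannot agree identically.
\<close>

lemma generic_edge_sqlen_inj:
  fixes p :: "nat \<Rightarrow> real ^ 'd"
  assumes p: "generic n p" and e: "edge_on n e" "edge_on n e'" and eq: "edge_sqlen p e = edge_sqlen p e'"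
  shows "e = e'"
proof (rule ccontr)
  assume "e \<noteq> e'"
  have vanish: "edge_sqlen y e - edge_sqlen y e' = 0" for y :: "nat \<Rightarrow> real ^ 'd"
    using generic_vanishing[OF p config_poly_diff[OF e[THEN config_poly_edge_sqlen]]] eq by simp
  obtain i j where ij: "e = {i, j}" "i \<noteq> j" using e(1) unfolding edge_on_def by blast
  obtain i' j' where ij': "e' = {i', j'}" "i' \<noteq> j'" using e(2) unfolding edge_on_def by blast
  obtain a where a: "a \<in> e" "a \<notin> e'" using ij ij' \<open>e \<noteq> e'\<close> by auto
  define y :: "nat \<Rightarrow> real ^ 'd" where "y b = (if b = a then axis undefined 1 else 0)" for b
  have "edge_sqlen y e = 1" using a(1) ij unfolding ij(1) edge_sqlen_pair
    by (auto simp: y_def norm_axis_1)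
  moreover have "edge_sqlen y e' = 0" using a(2) unfolding ij'(1) edge_sqlen_pair
    by (auto simp: y_def)
  ultimately show False using vanish[of y] by simp
qed

text \<open>
  The points are indexed by \<open>'d option\<close>, which has \<open>d + 1\<close> elements; the point \<open>None\<close> serves as
  origin.  The determinant of this matrix is nonzero iff the points are affinely independent.
\<close>

definition edge_vectors :: "('d option \<Rightarrow> real ^ 'd) \<Rightarrow> real ^ 'd ^ 'd" where
  "edge_vectors P = (\<chi> a. P (Some a) - P None)"

text \<open>
  At the configuration that consists of the origin and the unit vectors the matrix is the identity.
\<close>

lemma generic_det_edge_vectors:
  fixes p :: "nat \<Rightarrow> real ^ 'd" and s :: "'d option \<Rightarrow> nat"
  assumes p: "generic n p" and s: "inj s" "range s \<subseteq> {1..n}"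
  shows "det (edge_vectors (\<lambda>i. p (s i))) \<noteq> 0"
  unfolding edge_vectors_def
proof
  have s_in: "s a \<in> {1..n}" for a using s(2) by (simp only: image_subset_iff UNIV_I)
  assume 0: "det (\<chi> a. p (s (Some a)) - p (s None)) = 0"
  have vanish: "det (\<chi> a. y (s (Some a)) - y (s None)) = 0" for y :: "nat \<Rightarrow> real ^ 'd"
  proof (rule generic_vanishing[OF p, where f = "\<lambda>y. det (\<chi> a. y (s (Some a)) - y (s None))"])
    show "config_poly n (\<lambda>y :: nat \<Rightarrow> real ^ 'd. det (\<chi> a. y (s (Some a)) - y (s None)))"
      by (rule config_poly_det) (simp add: config_poly_diff config_poly_coord s_in[simplified])
  qed (rule 0)
  define y :: "nat \<Rightarrow> real ^ 'd" where
    "y b = (case inv s b of None \<Rightarrow> 0 | Some a \<Rightarrow> axis a 1)" for b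
  have "(\<chi> a. y (s (Some a)) - y (s None)) = (mat 1 :: real ^ 'd ^ 'd)"
    by (simp add: y_def inv_f_f[OF s(1)] vec_eq_iff mat_def axis_def)
  then show False using vanish[of y] by simp
qed

section \<open>Isometries between affinely independent point sets\<close>

lemma det_eq_0_iff_kernel:
  fixes A :: "real ^ 'n ^ 'n"
  shows "det A = 0 \<longleftrightarrow> (\<exists>z. z \<noteq> 0 \<and> A *v z = 0)"
  by (metis invertible_det_nz invertible_left_inverse matrix_left_invertible_ker)

text \<open>
  By polarisation the inner products of the difference vectors are determined by the distances.
\<close>

lemma edge_vectors_gram_cong:
  fixes P Q :: "'d::finite option \<Rightarrow> real ^ 'd"
  assumes "\<And>i j. norm (P i - P j) = norm (Q i - Q j)"
  shows "edge_vectors P ** transpose (edge_vectors P) = edge_vectors Q ** transpose (edge_vectors Q)"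
proof -
  have gram: "2 * (edge_vectors R ** transpose (edge_vectors R)) $ a $ b
      = (norm (R (Some a) - R None))\<^sup>2 + (norm (R (Some b) - R None))\<^sup>2 - (norm (R (Some a) - R (Some b)))\<^sup>2"
    for R :: "'d option \<Rightarrow> real ^ 'd" and a b
  proof -
    have "(edge_vectors R ** transpose (edge_vectors R)) $ a $ b
        = (R (Some a) - R None) \<bullet> (R (Some b) - R None)"
      by (simp add: edge_vectors_def matrix_matrix_mult_def transpose_def inner_vec_def)
    then show ?thesis
      by (simp add: power2_norm_eq_inner inner_diff inner_commute algebra_simps)
  qed
  have "2 * (edge_vectors P ** transpose (edge_vectors P)) $ a $ b
      = 2 * (edge_vectors Q ** transpose (edge_vectors Q)) $ a $ b" for a b
    by (simp only: gram assms)
  then show ?thesis by (simp add: vec_eq_iff)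
qed

lemma det_edge_vectors_cong:
  fixes P Q :: "'d::finite option \<Rightarrow> real ^ 'd"
  assumes "\<And>i j. norm (P i - P j) = norm (Q i - Q j)" "det (edge_vectors P) \<noteq> 0"
  shows "det (edge_vectors Q) \<noteq> 0"
proof -
  have "det (edge_vectors P) * det (edge_vectors P) = det (edge_vectors Q) * det (edge_vectors Q)"
    using arg_cong[OF edge_vectors_gram_cong[OF assms(1)], of det] by (simp add: det_mul det_transpose)
  then show ?thesis using assms(2) by auto
qed

text \<open>
  For matrices \<open>X\<close>, \<open>Y\<close> of difference vectors with \<open>X ** transpose X = Y ** transpose Y\<close> and \<open>X\<close>
  invertible, the matrix that maps the rows of \<open>X\<close> to those of \<open>Y\<close> is orthogonal.
\<close>

lemma isometry_between_simplices:
  fixes P Q :: "'d::finite option \<Rightarrow> real ^ 'd"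
  assumes dist: "\<And>i j. norm (P i - P j) = norm (Q i - Q j)" and det: "det (edge_vectors P) \<noteq> 0"
  obtains A :: "real ^ 'd \<Rightarrow> real ^ 'd"
  where "\<And>x y. norm (A x - A y) = norm (x - y)" "\<And>i. A (P i) = Q i"
proof -
  let ?X = "edge_vectors P" and ?Y = "edge_vectors Q"
  obtain Z where Z: "?X ** Z = mat 1" "Z ** ?X = mat 1"
    using det invertible_det_nz[of ?X] unfolding invertible_def by blast
  have ZX: "transpose Z ** transpose ?X = mat 1"
    using matrix_transpose_mul[of ?X Z] by (simp add: Z(1) transpose_mat)
  define R where "R = transpose ?Y ** transpose Z"
  have "transpose R ** R = Z ** (?Y ** transpose ?Y) ** transpose Z"
    by (simp add: R_def matrix_transpose_mul matrix_mul_assoc)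
  also have "\<dots> = (Z ** ?X) ** (transpose ?X ** transpose Z)"
    by (simp add: edge_vectors_gram_cong[OF dist, symmetric] matrix_mul_assoc)
  also have "\<dots> = mat 1"
    by (simp add: Z matrix_transpose_mul[symmetric] transpose_mat)
  finally have "orthogonal_matrix R" by (simp add: orthogonal_matrix)
  then have R_norm: "norm (R *v x) = norm x" for x
    using orthogonal_transformation_matrix[of "(*v) R"] by (simp add: orthogonal_transformation)
  have "R ** transpose ?X = transpose ?Y"
    by (simp add: R_def matrix_mul_assoc[symmetric] ZX)
  then have "column a (R ** transpose ?X) = column a (transpose ?Y)" for a by simp
  then have R_edge: "R *v (P (Some a) - P None) = Q (Some a) - Q None" for a
    by (simp add: column_def vec_eq_iff matrix_matrix_mult_def matrix_vector_mult_def transpose_def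
        edge_vectors_def)
  show ?thesis
  proof (rule that[of "\<lambda>x. R *v (x - P None) + Q None"])
    show "norm ((R *v (x - P None) + Q None) - (R *v (y - P None) + Q None)) = norm (x - y)" for x y
      by (simp add: matrix_vector_mult_diff_distrib[symmetric] R_norm)
    show "R *v (P i - P None) + Q None = Q i" for i
      by (cases i) (simp_all add: R_edge)
  qed
qed

text \<open>
  Subtracting the equations of two spheres leaves a linear one: \<open>x - y\<close> is orthogonal to every
  difference of two of the points, and these differences span the space.
\<close>

lemma point_determined_by_distances:
  fixes Q :: "'d::finite option \<Rightarrow> real ^ 'd"
  assumes det: "det (edge_vectors Q) \<noteq> 0" and dist: "\<And>i. norm (x - Q i) = norm (y - Q i)"
  shows "x = y"
proof -
  have eq: "(norm (x - Q i))\<^sup>2 = (norm (y - Q i))\<^sup>2" for i using dist by simp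
  have "(Q (Some a) - Q None) \<bullet> (x - y) = 0" for a
    using eq[of None] eq[of "Some a"]
    by (simp add: power2_norm_eq_inner inner_diff inner_commute)
  then have "edge_vectors Q *v (x - y) = 0"
    by (simp add: vec_eq_iff matrix_vector_mult_def edge_vectors_def inner_vec_def)
  then show ?thesis using det det_eq_0_iff_kernel[of "edge_vectors Q"] by (metis eq_iff_diff_eq_0)
qed

section \<open>Singular Gram matrices of squared distances\<close>

lemma sum_UNIV_option:
  fixes f :: "'a::finite option \<Rightarrow> 'b::comm_monoid_add"
  shows "(\<Sum>i\<in>UNIV. f i) = f None + (\<Sum>a\<in>UNIV. f (Some a))"
  by (simp add: UNIV_option_conv sum.reindex)

text \<open>
  Twice the Gram matrix of the vectors from point \<open>None\<close> to the others, expressed in squared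
  distances by the law of cosines.  The matrix makes sense for an arbitrary symmetric \<open>D\<close>, which
  need not come from points.
\<close>

definition gram_of_sqdist :: "('k option \<Rightarrow> 'k option \<Rightarrow> real) \<Rightarrow> real ^ 'k ^ 'k" where
  "gram_of_sqdist D = (\<chi> a b. D None (Some a) + D None (Some b) - D (Some a) (Some b))"

text \<open>
  There are \<open>d + 1\<close> difference vectors in dimension \<open>d\<close>, hence a linear dependency, whose
  coefficients form a kernel vector of their Gram matrix.
\<close>

lemma det_gram_of_points:
  fixes q :: "'d::finite option option \<Rightarrow> real ^ 'd"
  shows "det (gram_of_sqdist (\<lambda>i j. (norm (q i - q j))\<^sup>2)) = 0"
proof -
  let ?w = "\<lambda>a. q (Some a) - q None"
  let ?W = "(\<chi> k a. ?w a $ k) :: real ^ 'd option ^ 'd"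
  have "rank ?W \<noteq> CARD('d option)"
    using rank_bound[of ?W] by simp
  then obtain z where z: "z \<noteq> 0" "?W *v z = 0"
    using matrix_nonfull_linear_equations_eq by blast
  have gram: "gram_of_sqdist (\<lambda>i j. (norm (q i - q j))\<^sup>2) $ a $ b = 2 * (?w a \<bullet> ?w b)" for a b
  proof -
    have "q (Some a) - q (Some b) = ?w a - ?w b" by simp
    then have "(norm (q (Some a) - q (Some b)))\<^sup>2 = (norm (?w a))\<^sup>2 - 2 * (?w a \<bullet> ?w b) + (norm (?w b))\<^sup>2"
      by (simp only: power2_norm_eq_inner inner_diff inner_commute) (simp add: algebra_simps inner_commute)
    then show ?thesis
      by (simp add: gram_of_sqdist_def norm_minus_commute)
  qed
  have "gram_of_sqdist (\<lambda>i j. (norm (q i - q j))\<^sup>2) *v z = 0"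
  proof (rule vec_eq_iff[THEN iffD2, rule_format])
    fix a
    have "(gram_of_sqdist (\<lambda>i j. (norm (q i - q j))\<^sup>2) *v z) $ a = (\<Sum>b\<in>UNIV. 2 * (?w a \<bullet> ?w b) * z $ b)"
      by (simp add: matrix_vector_mult_def gram)
    also have "\<dots> = 2 * (?w a \<bullet> (\<Sum>b\<in>UNIV. z $ b *\<^sub>R ?w b))"
      by (simp add: inner_sum_right sum_distrib_left algebra_simps)
    also have "(\<Sum>b\<in>UNIV. z $ b *\<^sub>R ?w b) = ?W *v z"
      by (simp add: vec_eq_iff matrix_vector_mult_def mult.commute)
    also have "\<dots> = 0" by (rule z(2))
    finally show "(gram_of_sqdist (\<lambda>i j. (norm (q i - q j))\<^sup>2) *v z) $ a = 0 $ a"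
      by simp
  qed
  then show ?thesis
    using z(1) det_eq_0_iff_kernel by blast
qed

text \<open>
  The singularity of the Gram matrix in a form that treats all points alike.  The coefficient of
  the base point is chosen to make the total weight zero, and then the equations of the kernel say
  that \<open>\<Sum>i. z i * D i k\<close> has the same value for every \<open>k\<close> as for the base point.
\<close>

lemma gram_kernel_balanced:
  fixes D :: "'k::finite option \<Rightarrow> 'k option \<Rightarrow> real"
  assumes det: "det (gram_of_sqdist D) = 0"
    and sym: "\<And>i j. D i j = D j i" and diag: "\<And>i. D i i = 0"
  obtains z \<mu> where "z \<noteq> (\<lambda>_. 0)" "(\<Sum>i\<in>UNIV. z i) = 0" "\<And>k. (\<Sum>i\<in>UNIV. z i * D i k) = \<mu>"
proof -
  obtain y where y: "y \<noteq> 0" "gram_of_sqdist D *v y = 0"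
    using det det_eq_0_iff_kernel by blast
  define z where "z i = (case i of None \<Rightarrow> - (\<Sum>a\<in>UNIV. y $ a) | Some a \<Rightarrow> y $ a)" for i
  have "z \<noteq> (\<lambda>_. 0)"
  proof
    assume "z = (\<lambda>_. 0)"
    then have "y $ a = 0" for a by (metis z_def option.case(2))
    then show False using y(1) by (simp add: vec_eq_iff)
  qed
  moreover have "(\<Sum>i\<in>UNIV. z i) = 0"
    by (simp add: sum_UNIV_option z_def)
  moreover have "(\<Sum>i\<in>UNIV. z i * D i k) = (\<Sum>i\<in>UNIV. z i * D i None)" for k
  proof (cases k)
    case (Some a)
    have "0 = (gram_of_sqdist D *v y) $ a" by (simp add: y(2))
    also have "\<dots> = (\<Sum>b\<in>UNIV. y $ b * D None (Some a)) + (\<Sum>b\<in>UNIV. y $ b * D (Some b) None)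
        - (\<Sum>b\<in>UNIV. y $ b * D (Some b) (Some a))"
      unfolding matrix_vector_mult_def gram_of_sqdist_def sum.distrib[symmetric] sum_subtractf[symmetric]
      by (simp, intro sum.cong refl)
        (simp add: algebra_simps sym[of None "Some _"] sym[of "Some a" "Some _"])
    also have "\<dots> = (\<Sum>i\<in>UNIV. z i * D i None) - (\<Sum>i\<in>UNIV. z i * D i k)"
      by (simp add: sum_UNIV_option z_def Some diag sum_distrib_right[symmetric] sym[of "Some a" None])
    finally show ?thesis by simp
  qed simp
  ultimately show ?thesis by (rule that)
qed

text \<open>
  On vectors of total weight zero the form with \<open>D i j = 2\<close> off the diagonal is \<open>-2\<close> times the
  square of the norm.  A distortion of size at most \<open>1 / CARD('v)\<close> adds at most
  \<open>(\<Sum>i. \<bar>z i\<bar>)\<^sup>2 / CARD('v)\<close>, and by the Cauchy-Schwarz inequality this is at most the square of the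
  norm.
\<close>

lemma near_regular_negative:
  fixes D :: "'v::finite \<Rightarrow> 'v \<Rightarrow> real"
  assumes diag: "\<And>i. D i i = 0"
    and near: "\<And>i j. i \<noteq> j \<Longrightarrow> 2 \<le> D i j \<and> D i j \<le> 2 + 1 / CARD('v)"
    and z: "(\<Sum>i\<in>UNIV. z i) = 0"
  shows "(\<Sum>k\<in>UNIV. \<Sum>i\<in>UNIV. z k * z i * D i k) \<le> - (\<Sum>i\<in>UNIV. (z i)\<^sup>2)"
proof -
  let ?t = "1 / real CARD('v)"
  have term_le: "z k * z i * D i k \<le> z k * z i * 2 - (if i = k then 2 * (z k)\<^sup>2 else 0) + ?t * (\<bar>z k\<bar> * \<bar>z i\<bar>)" for i k
  proof (cases "i = k")
    case False
    have "z k * z i * (D i k - 2) \<le> \<bar>z k * z i\<bar> * (D i k - 2)"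
      using near[OF False] by (intro mult_right_mono) auto
    also have "\<dots> \<le> \<bar>z k * z i\<bar> * ?t"
      using near[OF False] by (intro mult_left_mono) auto
    finally show ?thesis using False by (simp add: algebra_simps abs_mult)
  qed (simp add: diag power2_eq_square)
  have "(\<Sum>k\<in>UNIV. \<Sum>i\<in>UNIV. z k * z i * D i k)
      \<le> (\<Sum>k\<in>UNIV. \<Sum>i\<in>UNIV. z k * z i * 2 - (if i = k then 2 * (z k)\<^sup>2 else 0) + ?t * (\<bar>z k\<bar> * \<bar>z i\<bar>))"
    by (intro sum_mono term_le)
  also have "\<dots> = (\<Sum>k\<in>UNIV. \<Sum>i\<in>UNIV. z k * z i * 2) - 2 * (\<Sum>k\<in>UNIV. (z k)\<^sup>2)
      + ?t * (\<Sum>k\<in>UNIV. \<Sum>i\<in>UNIV. \<bar>z k\<bar> * \<bar>z i\<bar>)"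
    by (simp add: sum.distrib sum_subtractf sum_distrib_left)
  also have "(\<Sum>k\<in>UNIV. \<Sum>i\<in>UNIV. z k * z i * 2) = (\<Sum>i\<in>UNIV. z i) * (\<Sum>i\<in>UNIV. z i) * 2"
    unfolding sum_product by (simp only: sum_distrib_right)
  also have "\<dots> = 0" by (simp add: z)
  also have "(\<Sum>k\<in>UNIV. \<Sum>i\<in>UNIV. \<bar>z k\<bar> * \<bar>z i\<bar>) = (\<Sum>i\<in>UNIV. \<bar>z i\<bar>)\<^sup>2"
    unfolding power2_eq_square sum_product ..
  also have "0 - 2 * (\<Sum>k\<in>UNIV. (z k)\<^sup>2) + ?t * (\<Sum>i\<in>UNIV. \<bar>z i\<bar>)\<^sup>2
      \<le> 0 - 2 * (\<Sum>k\<in>UNIV. (z k)\<^sup>2) + ?t * ((\<Sum>i\<in>UNIV. \<bar>z i\<bar>\<^sup>2) * CARD('v))"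
    using sum_squared_le_sum_of_squares[of "\<lambda>i. \<bar>z i\<bar>" UNIV]
    by (intro add_left_mono mult_left_mono) auto
  also have "\<dots> = - (\<Sum>i\<in>UNIV. (z i)\<^sup>2)" by simp
  finally show ?thesis .
qed

text \<open>
  A balanced kernel vector \<open>z\<close> is isotropic for the form given by \<open>D\<close>, which is definite here.
\<close>

lemma regular_gram_nonsingular:
  fixes D :: "'k::finite option \<Rightarrow> 'k option \<Rightarrow> real"
  assumes "\<And>i. D i i = 0" "\<And>i j. i \<noteq> j \<Longrightarrow> D i j = 2"
  shows "det (gram_of_sqdist D) \<noteq> 0"
proof
  assume 0: "det (gram_of_sqdist D) = 0"
  have sym: "D i j = D j i" for i j using assms(2)[of i j] assms(2)[of j i] by (cases "i = j") auto
  obtain z \<mu> where z: "z \<noteq> (\<lambda>_. 0)" "(\<Sum>i\<in>UNIV. z i) = 0" "\<And>k. (\<Sum>i\<in>UNIV. z i * D i k) = \<mu>"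
    using gram_kernel_balanced[OF 0 sym assms(1)] by metis
  have "(\<Sum>k\<in>UNIV. \<Sum>i\<in>UNIV. z k * z i * D i k) = (\<Sum>k\<in>UNIV. z k * \<mu>)"
    by (simp only: mult.assoc sum_distrib_left[symmetric] z(3))
  also have "\<dots> = 0" by (simp add: sum_distrib_right[symmetric] z(2))
  finally have "(\<Sum>i\<in>UNIV. (z i)\<^sup>2) \<le> 0"
    using near_regular_negative[of D z] assms z(2) by simp
  then have "(\<Sum>i\<in>UNIV. (z i)\<^sup>2) = 0" by (simp add: sum_nonneg antisym)
  then have "\<forall>i. z i = 0" by (simp add: sum_nonneg_eq_0_iff)
  then show False using z(1) by auto
qed

text \<open>
  Let \<open>z\<close> be a balanced kernel vector and \<open>u = e\<^sub>i - e\<^sub>j\<close>, which is isotropic for the form given by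
  \<open>D\<close>.  Then \<open>w = z + z j * u\<close> is isotropic as well, has total weight zero and vanishes at \<open>j\<close>.  So
  the only entry of \<open>D\<close> that is not near 2 has no influence on \<open>w\<close>, on which the form is definite.
  Hence \<open>w = 0\<close>, and \<open>z\<close> is a nonzero multiple of \<open>u\<close>.  Therefore \<open>D i k - D j k\<close> does not depend
  on \<open>k\<close>, and at \<open>k = i\<close> it is zero.
\<close>

lemma coincident_pair_rigid:
  fixes D :: "'k::finite option \<Rightarrow> 'k option \<Rightarrow> real"
  assumes det: "det (gram_of_sqdist D) = 0"
    and sym: "\<And>i j. D i j = D j i" and diag: "\<And>i. D i i = 0"
    and ij: "i \<noteq> j" "D i j = 0"
    and near: "\<And>k l. k \<noteq> l \<Longrightarrow> {k, l} \<noteq> {i, j} \<Longrightarrow> 2 \<le> D k l \<and> D k l \<le> 2 + 1 / CARD('k option)"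
  shows "D i k = D j k"
proof -
  obtain z \<mu> where z: "z \<noteq> (\<lambda>_. 0)" "(\<Sum>k\<in>UNIV. z k) = 0" "\<And>k. (\<Sum>i\<in>UNIV. z i * D i k) = \<mu>"
    using gram_kernel_balanced[OF det sym diag] by metis
  define u where "u k = (if k = i then 1 else if k = j then - 1 else 0 :: real)" for k
  have u_sum: "(\<Sum>k\<in>UNIV. u k * f k) = f i - f j" for f :: "'k option \<Rightarrow> real"
  proof -
    have "(\<Sum>k\<in>UNIV. u k * f k) = (\<Sum>k\<in>UNIV. (if k = i then f k else 0) - (if k = j then f k else 0))"
      using ij(1) by (intro sum.cong) (auto simp: u_def)
    then show ?thesis by (simp add: sum_subtractf)
  qed
  define w where "w k = z k + z j * u k" for k
  have wj: "w j = 0" using ij(1) by (simp add: w_def u_def)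
  have w0: "(\<Sum>k\<in>UNIV. w k) = 0"
    using u_sum[of "\<lambda>_. 1"] by (simp add: w_def sum.distrib z(2) sum_distrib_left[symmetric])
  (* the vanishing entry is replaced by 2, which w does not notice, to make D' nearly regular *)
  define D' where "D' k l = (if {k, l} = {i, j} then 2 else D k l)" for k l
  have wD: "(\<Sum>l\<in>UNIV. w l * D l k) = \<mu> + z j * (D i k - D j k)" for k
    by (simp add: w_def distrib_right sum.distrib z(3) mult.assoc sum_distrib_left[symmetric] u_sum)
  have "(\<Sum>k\<in>UNIV. \<Sum>l\<in>UNIV. w k * w l * D' l k) = (\<Sum>k\<in>UNIV. \<Sum>l\<in>UNIV. w k * w l * D l k)"
    using wj by (intro sum.cong) (auto simp: D'_def doubleton_eq_iff)
  also have "\<dots> = (\<Sum>k\<in>UNIV. w k * (\<mu> + z j * (D i k - D j k)))"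
    by (simp only: mult.assoc sum_distrib_left[symmetric] wD)
  also have "\<dots> = (\<Sum>k\<in>UNIV. w k) * \<mu> + z j * ((\<Sum>k\<in>UNIV. w k * D k i) - (\<Sum>k\<in>UNIV. w k * D k j))"
    unfolding sum_distrib_left sum_distrib_right sum_subtractf[symmetric] sum.distrib[symmetric]
    by (intro sum.cong refl) (simp add: sym[of i] sym[of j] algebra_simps)
  also have "\<dots> = 0"
    by (simp add: w0 wD diag ij(2) sym[of j i])
  finally have 0: "(\<Sum>k\<in>UNIV. \<Sum>l\<in>UNIV. w k * w l * D' l k) = 0" .
  have D'_diag: "D' k k = 0" for k
    using diag ij(1) by (auto simp: D'_def doubleton_eq_iff)
  have D'_near: "2 \<le> D' k l \<and> D' k l \<le> 2 + 1 / CARD('k option)" if "k \<noteq> l" for k l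
    using near[OF that] by (auto simp: D'_def)
  have "(\<Sum>k\<in>UNIV. (w k)\<^sup>2) \<le> 0"
    using near_regular_negative[of D', OF D'_diag D'_near w0] unfolding 0 by simp
  then have "(\<Sum>k\<in>UNIV. (w k)\<^sup>2) = 0" by (simp add: sum_nonneg antisym)
  then have w: "w k = 0" for k by (simp add: sum_nonneg_eq_0_iff)
  have "z j \<noteq> 0"
  proof
    assume "z j = 0"
    then have "z = (\<lambda>_. 0)" using w by (simp add: w_def fun_eq_iff)
    then show False using z(1) by simp
  qed
  moreover have "\<mu> + z j * (D i k - D j k) = 0" for k
    using wD[of k] by (simp add: w)
  from this[of k] this[of i] have "z j * (D i k - D j k) = 0"
    by (simp add: diag ij(2) sym[of j i])
  ultimately show ?thesis by simp
qed

text \<open>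
  The unit vectors together with a point \<open>(c, \<dots>, c)\<close>, whose squared distance to a unit vector is
  \<open>d c\<^sup>2 - 2 c + 1\<close>; the number \<open>c\<close> is the larger root of the resulting quadratic equation.
\<close>

lemma simplex_with_moved_vertex:
  assumes "0 \<le> t"
  obtains Y :: "'d::finite option \<Rightarrow> real ^ 'd"
  where "\<And>a b. a \<noteq> b \<Longrightarrow> (norm (Y (Some a) - Y (Some b)))\<^sup>2 = 2"
    and "\<And>a. (norm (Y None - Y (Some a)))\<^sup>2 = 2 + t"
proof -
  let ?d = "real CARD('d)"
  define c where "c = (1 + sqrt (1 + ?d * (1 + t))) / ?d"
  have "?d * c - 1 = sqrt (1 + ?d * (1 + t))" by (simp add: c_def)
  then have "(?d * c - 1)\<^sup>2 = 1 + ?d * (1 + t)" using assms by simp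
  then have "?d * (?d * c\<^sup>2 - 2 * c) = ?d * (1 + t)" by (simp add: power2_eq_square algebra_simps)
  then have c: "?d * c\<^sup>2 - 2 * c = 1 + t" by simp
  define Y :: "'d option \<Rightarrow> real ^ 'd" where
    "Y i = (case i of None \<Rightarrow> (\<chi> k. c) | Some a \<Rightarrow> axis a 1)" for i
  have axes: "axis a 1 \<bullet> axis b 1 = (0 :: real)" if "a \<noteq> b" for a b :: 'd
    using that by (simp add: inner_axis_axis)
  show ?thesis
  proof (rule that[of Y])
    fix a b :: 'd assume "a \<noteq> b"
    then show "(norm (Y (Some a) - Y (Some b)))\<^sup>2 = 2"
      by (simp add: Y_def power2_norm_eq_inner inner_diff axes inner_axis_axis)
  next
    fix a :: 'd
    have "(norm (Y None - Y (Some a)))\<^sup>2 = ?d * c\<^sup>2 - 2 * c + 1"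
      by (simp add: Y_def power2_norm_eq_inner inner_diff inner_axis_axis inner_axis inner_axis')
        (simp add: inner_vec_def power2_eq_square)
    then show "(norm (Y None - Y (Some a)))\<^sup>2 = 2 + t" using c by simp
  qed
qed

section \<open>Pairs, colourings and triangles\<close>

abbreviation pairs :: "'a set \<Rightarrow> 'a set set" where
  "pairs A \<equiv> {e. e \<subseteq> A \<and> card e = 2}"

lemma pairsE:
  assumes "e \<in> pairs A"
  obtains u v where "e = {u, v}" "u \<noteq> v" "u \<in> A" "v \<in> A"
proof -
  have "card e = 2" "e \<subseteq> A" using assms by auto
  then show ?thesis using that by (metis card_2_iff insert_subset)
qed

text \<open>
  A vertex of degree less than \<open>k\<close> can be removed and coloured last.  If there is none, counting
  incidences gives \<open>k * card V \<le> 2 * card F \<le> k * (k + 1)\<close>, so for \<open>k > 0\<close> there are at most \<open>k + 1\<close>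
  vertices, and if there are exactly \<open>k + 1\<close> then all pairs are edges.
\<close>

lemma colourable_or_complete:
  assumes "finite V" "F \<subseteq> pairs V" "card F \<le> Suc k choose 2"
  shows "(\<exists>col :: 'a \<Rightarrow> nat. (\<forall>v\<in>V. col v < k) \<and> (\<forall>u v. {u, v} \<in> F \<longrightarrow> col u \<noteq> col v)) \<or>
         (\<exists>T\<subseteq>V. card T = Suc k \<and> pairs T \<subseteq> F)"
  using assms
proof (induction V arbitrary: F rule: finite_psubset_induct)
  case (psubset V)
  have "finite F"
    using psubset.hyps psubset.prems(1) by (rule_tac finite_subset[of F "Pow V"]) auto
  show ?case
  proof (cases "\<exists>v\<in>V. card {e \<in> F. v \<in> e} < k")
    case True
    then obtain v where v: "v \<in> V" "card {e \<in> F. v \<in> e} < k" by blast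
    let ?F = "{e \<in> F. v \<notin> e}"
    have "card ?F \<le> card F" using \<open>finite F\<close> by (intro card_mono) auto
    then have "card ?F \<le> Suc k choose 2" using psubset.prems(2) by linarith
    moreover have "?F \<subseteq> pairs (V - {v})" using psubset.prems(1) by auto
    ultimately consider
      (col) col :: "'a \<Rightarrow> nat" where "\<forall>u\<in>V - {v}. col u < k" "\<forall>u w. {u, w} \<in> ?F \<longrightarrow> col u \<noteq> col w" |
      (complete) T where "T \<subseteq> V - {v}" "card T = Suc k" "pairs T \<subseteq> ?F"
      using psubset.IH[of "V - {v}" ?F] v(1) by blast
    then show ?thesis
    proof cases
      case col
      let ?N = "{u. {u, v} \<in> F}"
      have "inj_on (\<lambda>u. {u, v}) ?N" by (auto simp: inj_on_def doubleton_eq_iff)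
      then have "card ?N = card ((\<lambda>u. {u, v}) ` ?N)" by (rule card_image[symmetric])
      also have "\<dots> \<le> card {e \<in> F. v \<in> e}" using \<open>finite F\<close> by (intro card_mono) auto
      finally have "card ?N < k" using v(2) by linarith
      have "finite ?N"
        by (rule finite_subset[OF _ psubset.hyps]) (use psubset.prems(1) in auto)
      have "\<not> {..<k} \<subseteq> col ` ?N"
      proof
        assume "{..<k} \<subseteq> col ` ?N"
        then have "k \<le> card (col ` ?N)" using \<open>finite ?N\<close> card_mono[of "col ` ?N" "{..<k}"] by simp
        then show False using card_image_le[OF \<open>finite ?N\<close>, of col] \<open>card ?N < k\<close> by linarith
      qed
      then obtain c where c: "c < k" "c \<notin> col ` ?N" by auto
      have no_loop: "{v} \<notin> F" using psubset.prems(1) by auto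
      have "\<forall>u\<in>V. (col(v := c)) u < k" using col(1) c(1) by auto
      moreover have "(col(v := c)) u \<noteq> (col(v := c)) w" if "{u, w} \<in> F" for u w
      proof -
        consider "u = v" | "w = v" | "u \<noteq> v" "w \<noteq> v" by blast
        then show ?thesis
        proof cases
          case 1
          then have "w \<noteq> v" "w \<in> ?N" using that no_loop by (auto simp: insert_commute)
          then show ?thesis using 1 c(2) by auto
        next
          case 2
          then have "u \<noteq> v" "u \<in> ?N" using that no_loop by auto
          then show ?thesis using 2 c(2) by auto
        next
          case 3
          then show ?thesis using that col(2) by auto
        qed
      qed
      ultimately show ?thesis by blast
    next
      case complete
      then show ?thesis by blast
    qed
  next
    case False
    have "(\<Sum>v\<in>V. card {e \<in> F. v \<in> e}) = 2 * card F"
    proof (rule sum_multicount[OF psubset.hyps \<open>finite F\<close>], rule ballI)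
      fix e assume "e \<in> F"
      then have "{v \<in> V. v \<in> e} = e" "card e = 2" using psubset.prems(1) by auto
      then show "card {v \<in> V. v \<in> e} = 2" by simp
    qed
    moreover have "(\<Sum>v\<in>V. k) \<le> (\<Sum>v\<in>V. card {e \<in> F. v \<in> e})"
      using False by (intro sum_mono) (auto simp: not_less)
    ultimately have degree: "card V * k \<le> 2 * card F" by simp
    have choose: "2 * (Suc k choose 2) = Suc k * k"
      by (simp add: choose_two)
    show ?thesis
    proof (cases "card V \<le> k")
      case True
      obtain col and m :: nat where image: "col ` V = {i. i < m}" and inj: "inj_on col V"
        using finite_imp_inj_to_nat_seg[OF psubset.hyps] by auto
      have "m = card V" using card_image[OF inj] image by simp
      have col: "\<forall>v\<in>V. col v < k"
      proof
        fix v assume "v \<in> V"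
        then have "col v \<in> {i. i < m}" unfolding image[symmetric] by (rule imageI)
        then show "col v < k" using \<open>m = card V\<close> True by simp
      qed
      have "col u \<noteq> col v" if "{u, v} \<in> F" for u v
      proof -
        have "u \<in> V" "v \<in> V" "u \<noteq> v" using that psubset.prems(1) by force+
        then show ?thesis using inj by (simp add: inj_on_eq_iff)
      qed
      then show ?thesis using col by blast
    next
      case False
      show ?thesis
      proof (cases "k = 0")
        case True
        obtain v where "v \<in> V" using False by (metis card.empty ex_in_conv le0)
        then have "{v} \<subseteq> V" "card {v} = Suc k" "pairs {v} \<subseteq> F"
          using True by (auto simp: subset_singleton_iff)
        then show ?thesis by blast
      next
        case k: False
        have "card V * k \<le> Suc k * k" using degree choose psubset.prems(2) by linarith
        then have "card V \<le> Suc k" using k by (simp only: mult_le_cancel2)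
        then have "card V = Suc k" using False by simp
        moreover have "card (pairs V) = card V choose 2"
          by (rule n_subsets[OF psubset.hyps])
        ultimately have "card (pairs V) \<le> card F" using degree choose by simp
        then have "F = pairs V"
          using psubset.prems(1) psubset.hyps by (intro card_seteq) auto
        then show ?thesis using \<open>card V = Suc k\<close> by auto
      qed
    qed
  qed
qed

text \<open>
  The images of the pairs through \<open>i\<close> all share one vertex: if \<open>f {i, j} = {a, b}\<close> and
  \<open>f {i, k} = {a, c}\<close>, a pair \<open>f {i, l}\<close> that meets both but avoids \<open>a\<close> would be \<open>{b, c}\<close>, which is
  already taken by \<open>f {j, k}\<close>.  This vertex is the image of \<open>i\<close>.  That distinct points have distinct
  images is seen on a triangle containing both, since its three image pairs have no common vertex.
\<close>

lemma pair_map_induced_by_triangles: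
  fixes f :: "'v::finite set \<Rightarrow> 'a set"
  assumes card: "4 \<le> CARD('v)"
    and inj: "inj_on f (pairs UNIV)"
    and tri: "\<And>i j k. i \<noteq> j \<Longrightarrow> i \<noteq> k \<Longrightarrow> j \<noteq> k \<Longrightarrow>
      \<exists>a b c. a \<noteq> b \<and> a \<noteq> c \<and> b \<noteq> c \<and> f {i, j} = {a, b} \<and> f {i, k} = {a, c} \<and> f {j, k} = {b, c}"
  shows "\<exists>\<sigma>. inj \<sigma> \<and> (\<forall>i j. i \<noteq> j \<longrightarrow> f {i, j} = {\<sigma> i, \<sigma> j})"
proof -
  have other: "\<exists>k. k \<noteq> i \<and> k \<noteq> j" for i j :: 'v
  proof -
    have "card {i, j} \<le> 2" by (simp add: card_insert_if)
    then have "{i, j} \<noteq> UNIV" using card by (intro notI) simp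
    then show ?thesis by blast
  qed
  have "\<exists>s. \<forall>l. l \<noteq> i \<longrightarrow> s \<in> f {i, l}" for i
  proof -
    obtain j where j: "j \<noteq> i" using other[of i i] by blast
    obtain k where k: "k \<noteq> i" "k \<noteq> j" using other[of i j] by blast
    obtain a b c where abc: "a \<noteq> b" "a \<noteq> c" "b \<noteq> c" "f {i, j} = {a, b}" "f {i, k} = {a, c}" "f {j, k} = {b, c}"
      using tri[of i j k] j k by blast
    have "a \<in> f {i, l}" if l: "l \<noteq> i" for l
    proof (cases "l = j \<or> l = k")
      case False
      have "f {i, l} \<inter> f {i, j} \<noteq> {} \<and> card (f {i, l}) = 2" using tri[of i j l] j l False by force
      moreover have "f {i, l} \<inter> f {i, k} \<noteq> {}" using tri[of i k l] k l False by force
      moreover have "f {i, l} \<noteq> f {j, k}"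
      proof
        assume "f {i, l} = f {j, k}"
        then have "{i, l} = {j, k}" by (rule inj_onD[OF inj]) (use k l in auto)
        then show False using j k by (auto simp: doubleton_eq_iff)
      qed
      ultimately show ?thesis using abc by (auto simp: card_2_iff)
    qed (use abc in auto)
    then show ?thesis by blast
  qed
  then obtain \<sigma> where \<sigma>: "\<And>i l. l \<noteq> i \<Longrightarrow> \<sigma> i \<in> f {i, l}" by metis
  have "\<sigma> i \<noteq> \<sigma> j \<and> f {i, j} = {\<sigma> i, \<sigma> j}" if ij: "i \<noteq> j" for i j
  proof -
    obtain k where k: "k \<noteq> i" "k \<noteq> j" using other[of i j] by blast
    obtain a b c where "a \<noteq> b" "a \<noteq> c" "b \<noteq> c" "f {i, j} = {a, b}" "f {i, k} = {a, c}" "f {j, k} = {b, c}"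
      using tri[of i j k] ij k by blast
    moreover have "\<sigma> i \<in> f {i, j}" "\<sigma> i \<in> f {i, k}" "\<sigma> j \<in> f {i, j}" "\<sigma> j \<in> f {j, k}"
      using \<sigma>[of j i] \<sigma>[of k i] \<sigma>[of i j] \<sigma>[of k j] ij k by (simp_all add: insert_commute)
    ultimately show ?thesis by auto
  qed
  then show ?thesis by (metis injI)
qed

text \<open>
  Identifying \<open>b\<close> with \<open>a\<close> can make two distinct pairs equal only if one contains \<open>a\<close>, the other
  contains \<open>b\<close>, and they agree otherwise.
\<close>

lemma merged_pairs_cross:
  assumes e: "card e = 2" "card e' = 2" "e \<noteq> e'" and ab: "a \<noteq> b" "e \<noteq> {a, b}" "e' \<noteq> {a, b}"
    and merge: "(\<lambda>x. if x = b then a else x) ` e = (\<lambda>x. if x = b then a else x) ` e'"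
  shows "\<exists>c. c \<noteq> a \<and> c \<noteq> b \<and> {e, e'} = {{a, c}, {b, c}}"
proof -
  let ?r = "\<lambda>x. if x = b then a else x"
  have shape: "a \<notin> ?r ` X \<and> ?r ` X = X \<or>
      (\<exists>x c. X = {x, c} \<and> x \<in> {a, b} \<and> c \<notin> {a, b} \<and> ?r ` X = {a, c})"
    if X: "card X = 2" "X \<noteq> {a, b}" for X
  proof -
    obtain u v where uv: "X = {u, v}" "u \<noteq> v" using X(1) by (meson card_2_iff)
    consider "u \<in> {a, b}" "v \<notin> {a, b}" | "v \<in> {a, b}" "u \<notin> {a, b}" | "u \<notin> {a, b}" "v \<notin> {a, b}"
      using uv X(2) by (cases "u \<in> {a, b}"; cases "v \<in> {a, b}") auto
    then show ?thesis
    proof cases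
      case 1
      then have "?r ` X = {a, v}" by (auto simp: uv)
      then show ?thesis using 1 uv(1) by blast
    next
      case 2
      then have "?r ` X = {a, u}" by (auto simp: uv)
      moreover have "X = {v, u}" using uv(1) by auto
      ultimately show ?thesis using 2 by blast
    next
      case 3
      then have "?r ` X = X" by (auto simp: uv)
      moreover have "a \<notin> X" using 3 uv by auto
      ultimately show ?thesis by simp
    qed
  qed
  have "a \<in> ?r ` e"
  proof (rule ccontr)
    assume "a \<notin> ?r ` e"
    then have "?r ` e = e" "?r ` e' = e'"
      using shape[OF e(1) ab(2)] shape[OF e(2) ab(3)] merge by auto
    then show False using e(3) merge by simp
  qed
  then obtain x c x' c' where
    "e = {x, c}" "x \<in> {a, b}" "c \<notin> {a, b}" "?r ` e = {a, c}" and
    "e' = {x', c'}" "x' \<in> {a, b}" "c' \<notin> {a, b}" "?r ` e' = {a, c'}"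
    using shape[OF e(1) ab(2)] shape[OF e(2) ab(3)] unfolding merge by blast
  moreover from this have "c = c'" using merge by (metis doubleton_eq_iff)
  ultimately have "c \<noteq> a" "c \<noteq> b" "{e, e'} = {{a, c}, {b, c}}"
    using e(3) by auto
  then show ?thesis by blast
qed

section \<open>Complete graphs are recognised by their lengths\<close>

text \<open>
  Since the determinant vanishes for every \<open>y\<close>, it may be evaluated at the two kinds of test
  configuration: coloured regular simplices show that the values of \<open>f\<close> are exactly the pairs from
  a set \<open>T\<close> of \<open>d + 2\<close> vertices, and distorted simplices with two vertices of \<open>T\<close> merged show that
  \<open>f\<close> takes triangles to triangles.
\<close>

lemma vanishing_gram_induced:
  fixes f :: "'d::finite option option set \<Rightarrow> nat set"
  assumes d: "2 \<le> CARD('d)"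
    and edge: "\<And>i j. i \<noteq> j \<Longrightarrow> edge_on n (f {i, j})"
    and singular: "\<And>y :: nat \<Rightarrow> real ^ 'd.
      det (gram_of_sqdist (\<lambda>i j. if i = j then 0 else edge_sqlen y (f {i, j}))) = 0"
  shows "\<exists>\<sigma>. inj \<sigma> \<and> (\<forall>i j. i \<noteq> j \<longrightarrow> f {i, j} = {\<sigma> i, \<sigma> j})"
proof -
  let ?E = "pairs (UNIV :: 'd option option set)" and ?k = "CARD('d option)"
  have "card ?E = Suc ?k choose 2"
    using n_subsets[of "UNIV :: 'd option option set" 2] by simp
  have edge': "f e \<in> pairs {1..n}" if e: "e \<in> ?E" for e
  proof -
    obtain i j where "e = {i, j}" "i \<noteq> j" using pairsE[OF e] by metis
    then show ?thesis using edge[of i j] by (auto simp: edge_on_def)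
  qed
  have "card (f ` ?E) \<le> Suc ?k choose 2"
    using card_image_le[of ?E f] \<open>card ?E = _\<close> by simp
  then consider
    (col) col :: "nat \<Rightarrow> nat" where "\<forall>v\<in>{1..n}. col v < ?k" "\<forall>u v. {u, v} \<in> f ` ?E \<longrightarrow> col u \<noteq> col v" |
    (complete) T where "T \<subseteq> {1..n}" "card T = Suc ?k" "pairs T \<subseteq> f ` ?E"
    using colourable_or_complete[of "{1..n}" "f ` ?E" ?k] edge' by blast
  then show ?thesis
  proof cases
    case col
    obtain Y :: "'d option \<Rightarrow> real ^ 'd" where
      Y: "\<And>a b. a \<noteq> b \<Longrightarrow> (norm (Y (Some a) - Y (Some b)))\<^sup>2 = 2"
      "\<And>a. (norm (Y None - Y (Some a)))\<^sup>2 = 2 + 0"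
      using simplex_with_moved_vertex[of 0] by auto
    have regular: "(norm (Y a - Y b))\<^sup>2 = 2" if "a \<noteq> b" for a b
      using that Y by (cases a; cases b) (auto simp: norm_minus_commute[of _ "Y None"])
    obtain \<beta> :: "nat \<Rightarrow> 'd option" where \<beta>: "bij_betw \<beta> {..<?k} UNIV"
      using finite_same_card_bij[of "{..<?k}" "UNIV :: 'd option set"] by auto
    define y where "y v = Y (\<beta> (col v))" for v
    have "edge_sqlen y (f {i, j}) = 2" if ij: "i \<noteq> j" for i j
    proof -
      obtain u v where uv: "u \<in> {1..n}" "v \<in> {1..n}" "f {i, j} = {u, v}"
        using edge[OF ij] unfolding edge_on_def by blast
      have "{i, j} \<in> ?E" using ij by auto
      then have "{u, v} \<in> f ` ?E" unfolding uv(3)[symmetric] by (rule imageI)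
      then have "col u \<noteq> col v" using col(2) by blast
      then have "\<beta> (col u) \<noteq> \<beta> (col v)"
        using \<beta> col(1) uv(1,2) by (auto simp: bij_betw_def inj_on_def)
      then show ?thesis by (simp add: uv(3) edge_sqlen_pair y_def regular)
    qed
    then have "det (gram_of_sqdist (\<lambda>i j. if i = j then 0 else edge_sqlen y (f {i, j}))) \<noteq> 0"
      by (intro regular_gram_nonsingular) auto
    then show ?thesis using singular by blast
  next
    case complete
    have "finite T" using complete(2) by (intro card_ge_0_finite) simp
    then have "card (pairs T) = Suc ?k choose 2"
      using n_subsets[of T 2] complete(2) by simp
    moreover have "card (pairs T) \<le> card (f ` ?E)"
      using complete(3) by (intro card_mono) auto
    ultimately have cards: "card (f ` ?E) = card ?E" "card (pairs T) = card (f ` ?E)"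
      using card_image_le[of ?E f] \<open>card ?E = _\<close> by simp_all
    then have inj: "inj_on f ?E" by (intro eq_card_imp_inj_on) auto
    have image: "f ` ?E = pairs T"
      using card_subset_eq[OF _ complete(3)] cards(2) by simp
    have f_in: "f {i, j} \<in> pairs T" if "i \<noteq> j" for i j
      using that unfolding image[symmetric] by (intro imageI) auto
    have f_eq: "{i, j} = {k, l}" if "i \<noteq> j" "k \<noteq> l" "f {i, j} = f {k, l}" for i j k l
      using that by (intro inj_onD[OF inj]) auto
    have cross: "\<exists>c. c \<noteq> a \<and> c \<noteq> b \<and> {f {i, k}, f {j, k}} = {{a, c}, {b, c}}"
      if ijk: "i \<noteq> j" "i \<noteq> k" "j \<noteq> k" and ab: "f {i, j} = {a, b}" for i j k a b
    proof (rule merged_pairs_cross)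
      show "card (f {i, k}) = 2" "card (f {j, k}) = 2" using f_in[of i k] f_in[of j k] ijk by auto
      show "f {i, k} \<noteq> f {j, k}" "f {i, k} \<noteq> {a, b}" "f {j, k} \<noteq> {a, b}"
        using f_eq[of i k j k] f_eq[of i k i j] f_eq[of j k i j] ijk ab by (auto simp: doubleton_eq_iff)
      have abT: "a \<in> T" "b \<in> T" "a \<noteq> b" using f_in[OF ijk(1)] ab by (cases "a = b"; auto)+
      then show "a \<noteq> b" by simp
      let ?r = "\<lambda>x. if x = b then a else x"
      (* moving vertex s changes exactly the lengths of the edges at s, which must therefore
         contain both or none of the two edges in question *)
      have "s \<in> ?r ` f {i, k} \<longleftrightarrow> s \<in> ?r ` f {j, k}" if s: "s \<in> T - {b}" for s
      proof -
        have "card (T - {b}) = ?k" using complete(2) abT by simp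
        then obtain \<beta>\<^sub>0 :: "nat \<Rightarrow> 'd option" where \<beta>\<^sub>0: "bij_betw \<beta>\<^sub>0 (T - {b}) UNIV"
          using finite_same_card_bij[of "T - {b}" "UNIV :: 'd option set"] \<open>finite T\<close> by auto
        (* the bijection is adjusted so that s becomes the vertex that gets moved *)
        define \<beta> where "\<beta> x = Transposition.transpose (\<beta>\<^sub>0 s) None (\<beta>\<^sub>0 x)" for x
        have \<beta>: "inj_on \<beta> (T - {b})" "\<beta> s = None"
          using \<beta>\<^sub>0 by (auto simp: \<beta>_def bij_betw_def inj_on_def transpose_eq_iff)
        define t where "t = 1 / real CARD('d option option)"
        have "0 < t" by (simp add: t_def)
        obtain Y :: "'d option \<Rightarrow> real ^ 'd" where
          Y: "\<And>a b. a \<noteq> b \<Longrightarrow> (norm (Y (Some a) - Y (Some b)))\<^sup>2 = 2"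
          "\<And>a. (norm (Y None - Y (Some a)))\<^sup>2 = 2 + t"
          using simplex_with_moved_vertex[of t] \<open>0 < t\<close> by auto
        define y where "y x = Y (\<beta> (?r x))" for x
        have y_edge: "edge_sqlen y e = (if s \<in> ?r ` e then 2 + t else 2)"
          if e: "e \<in> pairs T" "e \<noteq> {a, b}" for e
        proof -
          obtain u v where uv: "e = {u, v}" "u \<noteq> v" "u \<in> T" "v \<in> T"
            using pairsE[OF e(1)] by metis
          have r: "?r u \<noteq> ?r v" "?r u \<in> T - {b}" "?r v \<in> T - {b}"
            using uv e(2) abT by (auto split: if_splits)
          have none: "\<beta> x = None \<longleftrightarrow> x = s" if "x \<in> T - {b}" for x
            using inj_on_eq_iff[OF \<beta>(1) that s] \<beta>(2) by simp
          have "\<beta> (?r u) \<noteq> \<beta> (?r v)" using inj_on_eq_iff[OF \<beta>(1) r(2,3)] r(1) by simp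
          then have "(norm (Y (\<beta> (?r u)) - Y (\<beta> (?r v))))\<^sup>2
              = (if \<beta> (?r u) = None \<or> \<beta> (?r v) = None then 2 + t else 2)"
            using Y by (cases "\<beta> (?r u)"; cases "\<beta> (?r v)") (auto simp: norm_minus_commute[of _ "Y None"])
          then show ?thesis
            unfolding uv(1) edge_sqlen_pair y_def none[OF r(2)] none[OF r(3)] by auto
        qed
        let ?D = "\<lambda>k l. if k = l then 0 else edge_sqlen y (f {k, l})"
        have "?D i k = ?D j k"
        proof (rule coincident_pair_rigid[of ?D, OF singular])
          show "?D k l = ?D l k" for k l by (simp add: insert_commute)
          show "?D i j = 0" by (simp add: ab edge_sqlen_pair y_def)
          fix k l :: "'d option option" assume kl: "k \<noteq> l" "{k, l} \<noteq> {i, j}"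
          then have "f {k, l} \<noteq> {a, b}" using f_eq[of k l i j] ijk(1) ab by auto
          then show "2 \<le> ?D k l \<and> ?D k l \<le> 2 + 1 / real CARD('d option option)"
            using y_edge[OF f_in[OF kl(1)]] kl(1) \<open>0 < t\<close> by (simp add: t_def)
        qed (use ijk(1) in auto)
        then have "edge_sqlen y (f {i, k}) = edge_sqlen y (f {j, k})" using ijk by simp
        then show ?thesis
          using y_edge[OF f_in[OF ijk(2)]] y_edge[OF f_in[OF ijk(3)]] \<open>0 < t\<close>
            \<open>f {i, k} \<noteq> {a, b}\<close> \<open>f {j, k} \<noteq> {a, b}\<close> by (auto split: if_splits)
      qed
      moreover have "?r ` f {i, k} \<subseteq> T - {b}" "?r ` f {j, k} \<subseteq> T - {b}"
        using f_in[OF ijk(2)] f_in[OF ijk(3)] abT by auto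
      ultimately show "?r ` f {i, k} = ?r ` f {j, k}" by blast
    qed
    show ?thesis
    proof (rule pair_map_induced_by_triangles[OF _ inj])
      show "4 \<le> CARD('d option option)" using d by simp
      fix i j k :: "'d option option" assume ijk: "i \<noteq> j" "i \<noteq> k" "j \<noteq> k"
      obtain a b where ab: "f {i, j} = {a, b}" "a \<noteq> b" using pairsE[OF f_in[OF ijk(1)]] by metis
      obtain c where c: "c \<noteq> a" "c \<noteq> b" "{f {i, k}, f {j, k}} = {{a, c}, {b, c}}"
        using cross[OF ijk ab(1)] by blast
      from c(3) consider "f {i, k} = {a, c} \<and> f {j, k} = {b, c}" | "f {i, k} = {b, c} \<and> f {j, k} = {a, c}"
        by (auto simp: doubleton_eq_iff)
      then show "\<exists>a b c. a \<noteq> b \<and> a \<noteq> c \<and> b \<noteq> c \<and> f {i, j} = {a, b} \<and> f {i, k} = {a, c} \<and> f {j, k} = {b, c}"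
      proof cases
        case 1 then show ?thesis using ab c by blast
      next
        case 2 then show ?thesis using ab c by (metis insert_commute)
      qed
    qed
  qed
qed

text \<open>
  The Gram determinant of the lengths \<open>edge_sqlen y (f {i, j})\<close> is a polynomial in \<open>y\<close> that is zero
  at \<open>p\<close>, because there the lengths are those of the points \<open>q\<close>, and so it is zero everywhere.
\<close>

lemma generic_realisation_unique:
  fixes p :: "nat \<Rightarrow> real ^ 'd" and q :: "'d option option \<Rightarrow> real ^ 'd"
  assumes d: "2 \<le> CARD('d)" and p: "generic n p"
    and edge: "\<And>i j. i \<noteq> j \<Longrightarrow> \<exists>e. edge_on n e \<and> edge_sqlen p e = (norm (q i - q j))\<^sup>2"
  shows "\<exists>\<sigma>. inj \<sigma> \<and> range \<sigma> \<subseteq> {1..n} \<and> (\<forall>i j. norm (p (\<sigma> i) - p (\<sigma> j)) = norm (q i - q j))"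
proof -
  define f where "f E = (SOME e. edge_on n e \<and> (\<forall>i j. E = {i, j} \<longrightarrow> edge_sqlen p e = (norm (q i - q j))\<^sup>2))"
    for E :: "'d option option set"
  have f: "edge_on n (f {i, j}) \<and> edge_sqlen p (f {i, j}) = (norm (q i - q j))\<^sup>2" if ij: "i \<noteq> j" for i j
  proof -
    have "\<exists>e. edge_on n e \<and> (\<forall>k l. {i, j} = {k, l} \<longrightarrow> edge_sqlen p e = (norm (q k - q l))\<^sup>2)"
      using edge[OF ij] by (auto simp: doubleton_eq_iff norm_minus_commute)
    then show ?thesis
      unfolding f_def by (rule someI2_ex) auto
  qed
  have "det (gram_of_sqdist (\<lambda>i j. if i = j then 0 else edge_sqlen y (f {i, j}))) = 0" for y :: "nat \<Rightarrow> real ^ 'd"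
  proof (rule generic_vanishing[OF p])
    have D: "config_poly n (\<lambda>y :: nat \<Rightarrow> real ^ 'd. if i = j then 0 else edge_sqlen y (f {i, j}))" for i j
      using f[of i j] by (cases "i = j") (auto intro: config_poly_zero config_poly_edge_sqlen)
    show "config_poly n (\<lambda>y :: nat \<Rightarrow> real ^ 'd.
        det (gram_of_sqdist (\<lambda>i j. if i = j then 0 else edge_sqlen y (f {i, j}))))"
      unfolding gram_of_sqdist_def
      by (rule config_poly_det, simp only: vec_lambda_beta) (intro config_poly_add config_poly_diff D)
    have "(\<lambda>i j. if i = j then 0 else edge_sqlen p (f {i, j})) = (\<lambda>i j. (norm (q i - q j))\<^sup>2)"
      using f by (auto simp: fun_eq_iff)
    then show "det (gram_of_sqdist (\<lambda>i j. if i = j then 0 else edge_sqlen p (f {i, j}))) = 0"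
      by (simp only: det_gram_of_points)
  qed
  then obtain \<sigma> where \<sigma>: "inj \<sigma>" "\<And>i j. i \<noteq> j \<Longrightarrow> f {i, j} = {\<sigma> i, \<sigma> j}"
    using vanishing_gram_induced[OF d, of n f] f by blast
  have "norm (p (\<sigma> i) - p (\<sigma> j)) = norm (q i - q j)" for i j
  proof (cases "i = j")
    case False
    then have "(norm (p (\<sigma> i) - p (\<sigma> j)))\<^sup>2 = (norm (q i - q j))\<^sup>2"
      using f[OF False] \<sigma>(2)[OF False] by (simp add: edge_sqlen_pair)
    then show ?thesis by simp
  qed simp
  moreover have "\<sigma> i \<in> {1..n}" for i
  proof -
    obtain j where "j \<noteq> i" by (metis option.distinct(1))
    then show ?thesis using f[of i j] \<sigma>(2)[of i j] by (auto simp: edge_on_def doubleton_eq_iff)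
  qed
  ultimately show ?thesis using \<sigma>(1) by blast
qed

section \<open>Placing the points one after another\<close>

text \<open>
  Any \<open>d + 1\<close> of the matched points of \<open>p\<close> are affinely independent and so determine an isometry; the
  remaining point must follow, being determined by its distances to the others.
\<close>

lemma base_placement:
  fixes p :: "nat \<Rightarrow> real ^ 'd" and q :: "'d option option \<Rightarrow> real ^ 'd"
  assumes d: "2 \<le> CARD('d)" and p: "generic n p"
    and edge: "\<And>i j. i \<noteq> j \<Longrightarrow> \<exists>e. edge_on n e \<and> edge_sqlen p e = (norm (q i - q j))\<^sup>2"
  obtains A :: "real ^ 'd \<Rightarrow> real ^ 'd"
  where "\<And>x y. norm (A x - A y) = norm (x - y)" "\<And>i. \<exists>x\<in>{1..n}. A (p x) = q i"
proof -
  obtain \<sigma> where \<sigma>: "inj \<sigma>" "range \<sigma> \<subseteq> {1..n}" "\<And>i j. norm (p (\<sigma> i) - p (\<sigma> j)) = norm (q i - q j)"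
    using generic_realisation_unique[of n p q, OF d p edge] by metis
  have det: "det (edge_vectors (\<lambda>i. p (\<sigma> (Some i)))) \<noteq> 0"
    using \<sigma>(1,2) by (intro generic_det_edge_vectors[OF p]) (auto simp: inj_def)
  obtain A where A: "\<And>x y. norm (A x - A y) = norm (x - y)" "\<And>i. A (p (\<sigma> (Some i))) = q (Some i)"
    using isometry_between_simplices[of "\<lambda>i. p (\<sigma> (Some i))" "\<lambda>i. q (Some i)", OF \<sigma>(3) det] by metis
  have "A (p (\<sigma> None)) = q None"
  proof (rule point_determined_by_distances)
    show "det (edge_vectors (\<lambda>i. q (Some i))) \<noteq> 0"
      by (rule det_edge_vectors_cong[OF _ det]) (rule \<sigma>(3))
    show "norm (A (p (\<sigma> None)) - q (Some i)) = norm (q None - q (Some i))" for i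
      by (simp only: A(2)[symmetric] A(1)) (simp only: A(2) \<sigma>(3))
  qed
  then have "A (p (\<sigma> i)) = q i" for i using A(2) by (cases i) auto
  then show ?thesis using that[of A] A(1) \<sigma>(2) by (metis rangeI subsetD)
qed

text \<open>
  The points \<open>y\<close> and \<open>r a\<close> form \<open>d + 2\<close> points all of whose distances occur in \<open>p\<close>, so they are
  matched with points of \<open>p\<close>.  The matching agrees with the given preimages \<open>x a\<close> of the \<open>r a\<close>,
  because distinct edges of \<open>p\<close> have distinct lengths and a point of a complete graph on at least
  three vertices is recovered as the intersection of two of its edges.
\<close>

lemma placement_step:
  fixes p :: "nat \<Rightarrow> real ^ 'd" and r :: "'d option \<Rightarrow> real ^ 'd"
  assumes d: "2 \<le> CARD('d)" and p: "generic n p"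
    and A: "\<And>x y. norm (A x - A y) = norm (x - y)"
    and r: "inj r" "\<And>a. \<exists>x\<in>{1..n}. A (p x) = r a"
    and edge: "\<And>a. \<exists>e. edge_on n e \<and> edge_sqlen p e = (norm (y - r a))\<^sup>2"
  shows "\<exists>x\<in>{1..n}. A (p x) = y"
proof -
  obtain x where x: "\<And>a. x a \<in> {1..n}" "\<And>a. A (p (x a)) = r a" using r(2) by metis
  have inj_x: "inj x" using r(1) x(2) by (metis injD injI)
  have r_dist: "norm (r a - r b) = norm (p (x a) - p (x b))" for a b
    by (simp only: x(2)[symmetric] A)
  define q where "q i = (case i of None \<Rightarrow> y | Some a \<Rightarrow> r a)" for i
  have "\<exists>e. edge_on n e \<and> edge_sqlen p e = (norm (q i - q j))\<^sup>2" if ij: "i \<noteq> j" for i j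
  proof (cases i; cases j)
    fix a b assume ab: "i = Some a" "j = Some b"
    then have "edge_on n {x a, x b}" using ij inj_x x(1) unfolding edge_on_def by (metis injD)
    then show ?thesis by (auto simp: ab q_def edge_sqlen_pair r_dist)
  qed (use ij edge in \<open>auto simp: q_def norm_minus_commute[of _ y]\<close>)
  then obtain \<sigma> where \<sigma>: "inj \<sigma>" "range \<sigma> \<subseteq> {1..n}" "\<And>i j. norm (p (\<sigma> i) - p (\<sigma> j)) = norm (q i - q j)"
    using generic_realisation_unique[OF d p, of q] by blast
  have pair: "{\<sigma> (Some a), \<sigma> (Some b)} = {x a, x b}" if "a \<noteq> b" for a b
  proof (rule generic_edge_sqlen_inj[OF p])
    show "edge_on n {\<sigma> (Some a), \<sigma> (Some b)}"
      using that \<sigma>(1,2) unfolding edge_on_def inj_def by blast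
    show "edge_on n {x a, x b}"
      using that inj_x x(1) unfolding edge_on_def inj_def by blast
    show "edge_sqlen p {\<sigma> (Some a), \<sigma> (Some b)} = edge_sqlen p {x a, x b}"
      by (simp add: edge_sqlen_pair \<sigma>(3) q_def r_dist)
  qed
  have \<sigma>_x: "\<sigma> (Some a) = x a" for a
  proof -
    have other: "\<exists>c. c \<notin> {a, b}" for b
    proof (rule ccontr)
      assume "\<nexists>c. c \<notin> {a, b}"
      then have "UNIV = {a, b}" by auto
      then have "CARD('d option) = card {a, b}" by simp
      then show False using d by (simp add: card_insert_if split: if_splits)
    qed
    obtain b where "b \<noteq> a" using other[of a] by blast
    moreover obtain c where "c \<noteq> a" "c \<noteq> b" using other[of b] by blast
    ultimately show ?thesis using pair[of a b] pair[of a c] inj_eq[OF inj_x, of b c]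
      by (metis doubleton_eq_iff)
  qed
  have "A (p (\<sigma> None)) = y"
  proof (rule point_determined_by_distances)
    have "det (edge_vectors (\<lambda>a. p (x a))) \<noteq> 0"
      using inj_x x(1) by (intro generic_det_edge_vectors[OF p]) auto
    then show "det (edge_vectors r) \<noteq> 0"
      by (rule det_edge_vectors_cong[rotated]) (simp add: r_dist)
    show "norm (A (p (\<sigma> None)) - r a) = norm (y - r a)" for a
      using \<sigma>(3)[of None "Some a"] by (simp add: x(2)[symmetric] A \<sigma>_x q_def)
  qed
  then show ?thesis using \<sigma>(2) by auto
qed

theorem theorem5p22:
  fixes p q :: "nat \<Rightarrow> real ^ 'd"
    and n n' :: nat
    and G H Gm :: "nat set list"
    and v vm :: "real list"
    and \<tau> :: "nat \<Rightarrow> nat"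
    and S :: "nat set"
  assumes d_ge: "2 \<le> CARD('d)"
    and n_ge: "CARD('d) + 2 \<le> n"
    and p_generic: "generic n p"
    and G_ensemble: "edge_ensemble n G"
    and v_eq: "v = measurement G p"
    and q_distinct: "inj_on q {1..n'}"
    and H_ensemble: "edge_ensemble n' H"
    and H_trilat: "allows_trilateration CARD('d) n' H"
    and vm_eq: "vm = measurement H q"
    and \<tau>_selects: "selects_positions (length vm) (length v) \<tau>"
    and vm_subseq: "vm = subseq_at \<tau> (length vm) v"
    and Gm_eq: "Gm = subseq_at \<tau> (length vm) G"
    and S_eq: "S = \<Union> (set Gm)"
  shows "\<exists>\<sigma>. bij_betw \<sigma> {1..n'} S \<and>
           congruent_config n' (\<lambda>i. p (\<sigma> i)) q \<and>
           (\<forall>t<length H. \<forall>i j. H ! t = {i, j} \<longrightarrow> Gm ! t = {\<sigma> i, \<sigma> j})"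
proof -
  let ?d = "CARD('d)"
  have lengths: "length vm = length H" "length v = length G" "length Gm = length H"
    by (simp_all add: vm_eq v_eq Gm_eq measurement_def subseq_at_def)
  have Gm_edge: "edge_on n (Gm ! t) \<and> edge_sqlen p (Gm ! t) = edge_sqlen q (H ! t)"
    if t: "t < length H" for t
  proof -
    have \<tau>: "\<tau> t < length G"
      using \<tau>_selects t lengths unfolding selects_positions_def by auto
    have "Gm ! t = G ! \<tau> t" using t lengths(1) by (simp add: Gm_eq subseq_at_def)
    moreover have "vm ! t = v ! \<tau> t"
      using t lengths(1) by (subst vm_subseq) (simp add: subseq_at_def)
    then have "edge_sqlen q (H ! t) = edge_sqlen p (G ! \<tau> t)"
      using t \<tau> by (simp add: vm_eq v_eq measurement_def)
    moreover have "edge_on n (G ! \<tau> t)"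
      using G_ensemble \<tau> unfolding edge_ensemble_def by simp
    ultimately show ?thesis by simp
  qed
  have measured: "\<exists>e. edge_on n e \<and> edge_sqlen p e = (norm (q i - q j))\<^sup>2" if "{i, j} \<in> set H" for i j
    using that Gm_edge by (metis edge_sqlen_pair in_set_conv_nth)
  have H_edge: "edge_on n' E" if "E \<in> set H" for E
    using H_ensemble that unfolding edge_ensemble_def by blast
  obtain \<pi> where \<pi>: "\<pi> permutes {1..n'}"
    and base: "\<And>i j. i \<in> {1..?d+2} \<Longrightarrow> j \<in> {1..?d+2} \<Longrightarrow> i \<noteq> j \<Longrightarrow> {\<pi> i, \<pi> j} \<in> set H"
    and step: "\<And>j. ?d + 2 < j \<Longrightarrow> j \<le> n' \<Longrightarrow>
      \<exists>I. I \<subseteq> {1..<j} \<and> card I = ?d + 1 \<and> (\<forall>i\<in>I. {\<pi> i, \<pi> j} \<in> set H)"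
    using H_trilat unfolding allows_trilateration_def by blast
  have \<pi>_in: "\<pi> i \<in> {1..n'} \<longleftrightarrow> i \<in> {1..n'}" for i by (rule permutes_in_image[OF \<pi>])
  have \<pi>_inj: "inj \<pi>" by (rule permutes_inj[OF \<pi>])

  obtain s :: "'d option option \<Rightarrow> nat" where s: "bij_betw s UNIV {1..?d+2}"
    using finite_same_card_bij[of "UNIV :: 'd option option set" "{1..?d+2}"] by auto
  have s_edge: "\<exists>e. edge_on n e \<and> edge_sqlen p e = (norm (q (\<pi> (s i)) - q (\<pi> (s j))))\<^sup>2" if "i \<noteq> j" for i j
  proof (rule measured[OF base])
    show "s i \<in> {1..?d+2}" "s j \<in> {1..?d+2}" "s i \<noteq> s j"
      using s that unfolding bij_betw_def inj_def by auto
  qed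
  obtain A where A: "\<And>x y. norm (A x - A y) = norm (x - y)"
    and A_base: "\<And>i. \<exists>x\<in>{1..n}. A (p x) = q (\<pi> (s i))"
    using base_placement[of n p "\<lambda>i. q (\<pi> (s i))", OF d_ge p_generic s_edge] by metis

  (* the isometry stays the same; each step only finds a preimage of the next point *)
  have placed: "j \<in> {1..n'} \<Longrightarrow> \<exists>x\<in>{1..n}. A (p x) = q (\<pi> j)" for j
  proof (induction j rule: less_induct)
    case (less j)
    show ?case
    proof (cases "j \<le> ?d + 2")
      case True
      then have "j \<in> range s" using less.prems s unfolding bij_betw_def by auto
      then show ?thesis using A_base by blast
    next
      case False
      then obtain I where I: "I \<subseteq> {1..<j}" "card I = ?d + 1" "\<And>i. i \<in> I \<Longrightarrow> {\<pi> i, \<pi> j} \<in> set H"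
        using step[of j] less.prems by auto
      have "finite I" using I(2) by (intro card_ge_0_finite) simp
      then obtain \<beta> :: "'d option \<Rightarrow> nat" where \<beta>: "bij_betw \<beta> UNIV I"
        using finite_same_card_bij[of "UNIV :: 'd option set" I] I(2) by auto
      have \<beta>_in: "\<beta> a \<in> I" for a using \<beta> unfolding bij_betw_def by auto
      then have \<beta>_n': "\<beta> a \<in> {1..n'}" "\<beta> a < j" for a
        using I(1) less.prems by (auto dest!: subsetD[of I _ "\<beta> a"])
      show ?thesis
      proof (rule placement_step[OF d_ge p_generic A, where r = "\<lambda>a. q (\<pi> (\<beta> a))"])
        show "inj (\<lambda>a. q (\<pi> (\<beta> a)))"
        proof (rule injI)
          fix a b assume "q (\<pi> (\<beta> a)) = q (\<pi> (\<beta> b))"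
          then have "\<pi> (\<beta> a) = \<pi> (\<beta> b)" using inj_onD[OF q_distinct] \<beta>_n'(1) \<pi>_in by blast
          then show "a = b" using \<pi>_inj \<beta> unfolding bij_betw_def inj_def by blast
        qed
        show "\<exists>x\<in>{1..n}. A (p x) = q (\<pi> (\<beta> a))" for a
          by (rule less.IH[OF \<beta>_n'(2,1)])
        show "\<exists>e. edge_on n e \<and> edge_sqlen p e = (norm (q (\<pi> j) - q (\<pi> (\<beta> a))))\<^sup>2" for a
          using measured[OF I(3)[OF \<beta>_in]] by (simp add: norm_minus_commute)
      qed
    qed
  qed
  have "\<exists>x\<in>{1..n}. A (p x) = q i" if "i \<in> {1..n'}" for i
  proof -
    obtain j where "\<pi> j = i" using permutes_surj[OF \<pi>] by (metis surjD)
    then show ?thesis using placed[of j] \<pi>_in[of j] that by simp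
  qed
  then obtain \<sigma> where \<sigma>: "\<And>i. i \<in> {1..n'} \<Longrightarrow> \<sigma> i \<in> {1..n} \<and> A (p (\<sigma> i)) = q i" by metis
  have inj: "inj_on \<sigma> {1..n'}"
  proof (rule inj_onI)
    fix i j assume "i \<in> {1..n'}" "j \<in> {1..n'}" "\<sigma> i = \<sigma> j"
    then show "i = j" using \<sigma>[of i] \<sigma>[of j] inj_onD[OF q_distinct] by metis
  qed

  have labels: "Gm ! t = {\<sigma> i, \<sigma> j}" if t: "t < length H" and ij: "H ! t = {i, j}" for t i j
  proof (rule generic_edge_sqlen_inj[OF p_generic])
    have "edge_on n' {i, j}" using H_edge[OF nth_mem[OF t]] ij by simp
    then have in_n': "i \<in> {1..n'}" "j \<in> {1..n'}" "i \<noteq> j"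
      unfolding edge_on_def by (auto simp: doubleton_eq_iff)
    then show "edge_on n {\<sigma> i, \<sigma> j}"
      using \<sigma>[of i] \<sigma>[of j] inj_onD[OF inj] unfolding edge_on_def by blast
    show "edge_on n (Gm ! t)" using Gm_edge[OF t] by blast
    have "norm (p (\<sigma> i) - p (\<sigma> j)) = norm (q i - q j)"
      using A[of "p (\<sigma> i)" "p (\<sigma> j)"] \<sigma> in_n' by simp
    then show "edge_sqlen p (Gm ! t) = edge_sqlen p {\<sigma> i, \<sigma> j}"
      using Gm_edge[OF t] by (simp add: ij edge_sqlen_pair)
  qed

  have partner: "\<exists>k. {\<pi> j, k} \<in> set H" if j: "1 \<le> j" "j \<le> ?d + 2 \<or> j \<le> n'" for j
  proof (cases "j \<le> ?d + 2")
    case True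
    define i where "i = (if j = 1 then 2 else 1 :: nat)"
    have "{\<pi> j, \<pi> i} \<in> set H" using True j(1) by (intro base) (auto simp: i_def)
    then show ?thesis by blast
  next
    case False
    then obtain I where I: "card I = ?d + 1" "\<forall>i\<in>I. {\<pi> i, \<pi> j} \<in> set H" using step[of j] j(2) by auto
    then obtain i where "i \<in> I" by fastforce
    then show ?thesis using I(2) by (metis insert_commute)
  qed
  have "\<Union> (set H) = {1..n'}"
  proof (intro equalityI subsetI)
    fix i assume "i \<in> \<Union> (set H)"
    then show "i \<in> {1..n'}" using H_edge unfolding edge_on_def by fastforce
  next
    fix i assume i: "i \<in> {1..n'}"
    obtain j where "\<pi> j = i" using permutes_surj[OF \<pi>] by (metis surjD)
    then show "i \<in> \<Union> (set H)" using partner[of j] \<pi>_in[of j] i by auto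
  qed
  moreover have "Gm ! t = \<sigma> ` (H ! t)" if t: "t < length H" for t
  proof -
    obtain i j where "H ! t = {i, j}" using H_edge[OF nth_mem[OF t]] unfolding edge_on_def by auto
    then show ?thesis using labels[OF t] by simp
  qed
  then have "Gm = map (\<lambda>E. \<sigma> ` E) H" using lengths(3) by (simp add: list_eq_iff_nth_eq)
  ultimately have "\<sigma> ` {1..n'} = S" by (auto simp: S_eq image_Union)
  moreover have "congruent_config n' (\<lambda>i. p (\<sigma> i)) q"
    unfolding congruent_config_def using A \<sigma> by (intro exI[of _ A]) (auto simp: dist_norm)
  ultimately show ?thesis using inj labels unfolding bij_betw_def by blast
qed

end
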